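(* Let $h\ge 1$, assume $\boldsymbol{\gamma}_{h-1}$ and $\boldsymbol{\gamma}_h$ are linearly independent vectors in $\mathbb{R}^L$, put $\mathbf{d}:=\boldsymbol{\gamma}_{h-1}-\boldsymbol{\gamma}_h$, let $\beta_h\in\mathbb{R}$ with $|\beta_h|\le\|\mathbf{d}\|$, and put $\alpha:=\beta_h/\|\mathbf{d}\|$. Consider $$\max_{\mathbf{b}\in\mathbb{R}^L}\ \boldsymbol{\gamma}_h'\mathbf{b}\quad\text{subject to}\quad (\boldsymbol{\gamma}_{h-1}-\boldsymbol{\gamma}_h)'\mathbf{b}=\beta_h,\qquad \mathbf{b}'\mathbf{b}=1 .$$ (1) If $|\alpha|<1$, the solution has the form $\mathbf{b}=\lambda_1\boldsymbol{\gamma}_h+\lambda_2(\boldsymbol{\gamma}_{h-1}-\boldsymbol{\gamma}_h)$ for some scalars $\lambda_1,\lambda_2$. (1a) If $\mathbf{d}'\boldsymbol{\gamma}_h\ne0$, then $\lambda_1=\dfrac{\alpha\|\mathbf{d}\|-\lambda_2\mathbf{d}'\mathbf{d}}{\mathbf{d}'\boldsymbol{\gamma}_h}$ and $\lambda_2$ is a root of the quadratic $A\lambda_2^2+B\lambda_2+C=0$ with $$A=\mathbf{d}'\mathbf{d}\left(\frac{\mathbf{d}'\mathbf{d}\,\boldsymbol{\gamma}_h'\boldsymbol{\gamma}_h}{(\mathbf{d}'\boldsymbol{\gamma}_h)^2}-1\right),\quad B=2\alpha\|\mathbf{d}\|\left(1-\frac{\mathbf{d}'\mathbf{d}\,\boldsymbol{\gamma}_h'\boldsymbol{\gamma}_h}{(\mathbf{d}'\boldsymbol{\gamma}_h)^2}\right),\quad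 C=\frac{\alpha^2\mathbf{d}'\mathbf{d}\,\boldsymbol{\gamma}_h'\boldsymbol{\gamma}_h}{(\mathbf{d}'\boldsymbol{\gamma}_h)^2}-1,$$ namely the root for which the objective $\boldsymbol{\gamma}_h'\mathbf{b}$ is larger. (1b) If $\mathbf{d}'\boldsymbol{\gamma}_h=0$, then $\lambda_2=\alpha/\|\mathbf{d}\|$ and $\lambda_1=\pm\sqrt{(1-\alpha^2)/(\boldsymbol{\gamma}_h'\boldsymbol{\gamma}_h)}$, with the sign for which the objective is larger. (2) If $|\alpha|=1$, the solution is $\mathbf{b}=\mathrm{sign}(\alpha)\,\mathbf{d}/\|\mathbf{d}\|$.
   Context: $(\gamma_k)_{k\in\mathbb{Z}}$ is a square-summable real sequence, $L\ge 1$ is an integer, and for each integer $h\ge 0$, $\boldsymbol{\gamma}_h:=(\gamma_h,\gamma_{h+1},\dots,\gamma_{h+L-1})'\in\mathbb{R}^L$. A prime denotes transposition and $\|\cdot\|$ is the Euclidean norm. "Solution" means a maximizer of the problem. *)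

theory Defs
  imports "HOL-Analysis.Analysis"
begin

text \<open>Vectors in $\mathbb{R}^L$ are rendered as \<^typ>\<open>real ^ 'n\<close> with $L$ the cardinality of
  \<^typ>\<open>'n\<close>. The linear order on the index type fixes which component is the first, second, etc.:
  the index \<open>i\<close> has zero-based position \<open>card {..<i}\<close>.\<close>

definition index_pos :: "'n::{finite,linorder} \<Rightarrow> nat" where
  "index_pos i = card {..<i}"

lemma bij_betw_index_pos:
  "bij_betw (index_pos :: 'n::{finite,linorder} \<Rightarrow> nat) UNIV {..<CARD('n)}"
proof -
  have mono: "index_pos i < index_pos j" if "i < j" for i j :: 'n
    unfolding index_pos_def using that by (intro psubset_card_mono) auto
  have inj: "inj (index_pos :: 'n \<Rightarrow> nat)"
    by (rule linorder_injI) (metis mono nat_neq_iff)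
  have "index_pos i < CARD('n)" for i :: 'n
    unfolding index_pos_def by (intro psubset_card_mono) auto
  then have "range (index_pos :: 'n \<Rightarrow> nat) \<subseteq> {..<CARD('n)}" by auto
  moreover have "card (range (index_pos :: 'n \<Rightarrow> nat)) = CARD('n)"
    using inj by (rule card_image)
  ultimately have "range (index_pos :: 'n \<Rightarrow> nat) = {..<CARD('n)}"
    by (intro card_subset_eq) auto
  with inj show ?thesis by (simp add: bij_betw_def)
qed

definition gvec :: "(int \<Rightarrow> real) \<Rightarrow> nat \<Rightarrow> real ^ 'n::{finite,linorder}" where
  "gvec \<gamma> h = (\<chi> i. \<gamma> (int h + int (index_pos i)))"

text \<open>In the following, \<open>g0\<close> and \<open>g\<close> stand for $\gamma_{h-1}$ and $\gamma_h$.\<close>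

definition feasible :: "real ^ 'n \<Rightarrow> real ^ 'n \<Rightarrow> real \<Rightarrow> real ^ 'n \<Rightarrow> bool" where
  "feasible g0 g \<beta> b \<longleftrightarrow> (g0 - g) \<bullet> b = \<beta> \<and> b \<bullet> b = 1"

definition solution :: "real ^ 'n \<Rightarrow> real ^ 'n \<Rightarrow> real \<Rightarrow> real ^ 'n \<Rightarrow> bool" where
  "solution g0 g \<beta> b \<longleftrightarrow> is_arg_max (\<lambda>x. g \<bullet> x) (feasible g0 g \<beta>) b"

end

theory Submission
  imports Defs
begin

text \<open>Put \<open>D = d \<bullet> d\<close>, \<open>m = d \<bullet> g\<close> and let \<open>P = D (g \<bullet> g) - m\<^sup>2\<close> be the Gram determinant. The vector
  \<open>v = K g + (\<beta> / D - K m / D) d\<close> with \<open>K = sqrt ((D - \<beta>\<^sup>2) / P)\<close> is feasible. Any other feasible \<open>x\<close>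
  has the same norm as \<open>v\<close> and the same inner product with \<open>d\<close>, so
  \<open>K (g \<bullet> v - g \<bullet> x) = v \<bullet> v - v \<bullet> x = (norm (x - v))\<^sup>2 / 2\<close>.
  Hence \<open>v\<close> is the unique maximizer, also when \<open>K = 0\<close>, where it is the only feasible point. The
  other root of the quadratic is obtained by replacing \<open>K\<close> with \<open>-K\<close>.\<close>

lemma independent_pair_diff:
  fixes u v :: "'a::real_vector"
  assumes "u \<noteq> v" "independent {u, v}" and z: "p *\<^sub>R v + q *\<^sub>R (u - v) = 0"
  shows "p = 0 \<and> q = 0"
proof -
  \<comment> \<open>Expanding \<open>p *\<^sub>R v + q *\<^sub>R (u - v)\<close> gives
    \<open>u\<close> the coefficient \<open>q\<close> and \<open>v\<close> the coefficient
    \<open>p - q\<close>.\<close>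
  let ?c = "\<lambda>x. if x = u then q else p - q"
  have s: "(\<Sum>x\<in>{u, v}. ?c x *\<^sub>R x) = 0"
    using z assms(1) by (simp add: algebra_simps)
  have "?c u = 0" "?c v = 0"
    by (rule independentD[OF assms(2) _ _ s]; simp)+
  then show ?thesis using assms(1) by simp
qed

text \<open>Strict Cauchy-Schwarz: the vector \<open>?w\<close> is \<open>d \<bullet> d\<close>
  times the component of \<open>g\<close> orthogonal to \<open>d\<close>, nonzero by independence,
  and its squared length is \<open>d \<bullet> d\<close> times the determinant.\<close>

lemma gram_determinant_pos:
  fixes g d :: "'a::real_inner"
  assumes indep: "\<And>p q. p *\<^sub>R g + q *\<^sub>R d = 0 \<Longrightarrow> p = 0 \<and> q = 0"
  shows "(d \<bullet> d) * (g \<bullet> g) - (d \<bullet> g)\<^sup>2 > 0"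
proof -
  have d: "d \<bullet> d > 0" using indep[of 0 1] by auto
  let ?w = "(d \<bullet> d) *\<^sub>R g + (- (d \<bullet> g)) *\<^sub>R d"
  have "?w \<noteq> 0" using indep[of "d \<bullet> d" "- (d \<bullet> g)"] d by linarith
  then have "0 < ?w \<bullet> ?w" by (rule inner_gt_zero_iff[THEN iffD2])
  also have "?w \<bullet> ?w = (d \<bullet> d) * ((d \<bullet> d) * (g \<bullet> g) - (d \<bullet> g)\<^sup>2)"
    by (simp add: inner_simps inner_commute[of g d] power2_eq_square algebra_simps)
  finally show ?thesis using d by (simp add: zero_less_mult_iff)
qed

text \<open>The form of \<open>v\<close> is Lagrange stationarity with the multipliers cleared of
  denominators, so that \<open>K = 0\<close>, with \<open>v\<close> a multiple of \<open>d\<close>,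
  is covered too. The sign of \<open>K\<close> separates maximum from minimum.\<close>

lemma is_arg_max_sphere_slice_iff:
  fixes g d v :: "'a::real_inner"
  assumes v: "v = K *\<^sub>R g + c *\<^sub>R d" and K: "K \<ge> 0"
    and dv: "d \<bullet> v = \<beta>" and vv: "v \<bullet> v = 1"
  shows "is_arg_max (\<lambda>x. g \<bullet> x) (\<lambda>x. d \<bullet> x = \<beta> \<and> x \<bullet> x = 1) b \<longleftrightarrow> b = v"
proof -
  have gap: "K * (g \<bullet> v - g \<bullet> x) = (x - v) \<bullet> (x - v) / 2"
    if "d \<bullet> x = \<beta>" "x \<bullet> x = 1" for x
  proof -
    have "v \<bullet> x = K * (g \<bullet> x) + c * \<beta>" "v \<bullet> v = K * (g \<bullet> v) + c * \<beta>"
      using that dv by (subst v; simp add: inner_simps)+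
    then have "K * (g \<bullet> v - g \<bullet> x) = 1 - v \<bullet> x"
      using vv by (simp add: algebra_simps)
    then show ?thesis using that vv by (simp add: inner_simps inner_commute[of x v])
  qed
  have le: "g \<bullet> x \<le> g \<bullet> v" and eq: "g \<bullet> x = g \<bullet> v \<Longrightarrow> x = v"
    if "d \<bullet> x = \<beta>" "x \<bullet> x = 1" for x
  proof -
    show "x = v" if "g \<bullet> x = g \<bullet> v" using gap[OF \<open>d \<bullet> x = \<beta>\<close> \<open>x \<bullet> x = 1\<close>] that by simp
    show "g \<bullet> x \<le> g \<bullet> v"
    proof (cases "K = 0")
      \<comment> \<open>Here the gap identity reads
        \<open>0 = (x - v) \<bullet> (x - v) / 2\<close>, so \<open>x = v\<close>.\<close>
      case True
      then show ?thesis using gap[OF that] by simp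
    next
      case False
      have "0 \<le> K * (g \<bullet> v - g \<bullet> x)" by (simp add: gap[OF that])
      then show ?thesis using False K by (simp add: zero_le_mult_iff)
    qed
  qed
  show ?thesis
    unfolding is_arg_max_def using le eq dv vv by (force simp: not_less antisym)
qed

theorem mainTheorem6:
  fixes \<gamma> :: "int \<Rightarrow> real" and h :: nat
    and g0 g d :: "real ^ 'n::{finite,linorder}"
    and \<beta> \<alpha> A B C :: real and pt :: "real \<Rightarrow> real \<Rightarrow> real ^ 'n::{finite,linorder}" and coef1 :: "real \<Rightarrow> real"
  assumes square_summable: "(\<lambda>k. (\<gamma> k)\<^sup>2) summable_on UNIV"
    and h: "h \<ge> 1"
    and g0: "g0 = gvec \<gamma> (h - 1)"
    and g: "g = gvec \<gamma> h"
    and indep: "g0 \<noteq> g" "independent {g0, g}"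
    and d: "d = g0 - g"
    and \<beta>: "\<bar>\<beta>\<bar> \<le> norm d"
    and \<alpha>: "\<alpha> = \<beta> / norm d"
    and A: "A = (d \<bullet> d) * ((d \<bullet> d) * (g \<bullet> g) / (d \<bullet> g)\<^sup>2 - 1)"
    and B: "B = 2 * \<alpha> * norm d * (1 - (d \<bullet> d) * (g \<bullet> g) / (d \<bullet> g)\<^sup>2)"
    and C: "C = \<alpha>\<^sup>2 * (d \<bullet> d) * (g \<bullet> g) / (d \<bullet> g)\<^sup>2 - 1"
    and pt: "pt = (\<lambda>x y. x *\<^sub>R g + y *\<^sub>R d)"
    and coef1: "coef1 = (\<lambda>y. (\<alpha> * norm d - y * (d \<bullet> d)) / (d \<bullet> g))"
  shows "(\<exists>!b. solution g0 g \<beta> b) \<and>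
    (\<forall>b. solution g0 g \<beta> b \<longrightarrow>
      (\<bar>\<alpha>\<bar> < 1 \<longrightarrow>
        (\<exists>l1 l2. b = pt l1 l2) \<and>
        (\<forall>l1 l2. b = pt l1 l2 \<longrightarrow>
          (d \<bullet> g \<noteq> 0 \<longrightarrow>
            l1 = coef1 l2 \<and>
            (\<exists>\<mu>. \<mu> \<noteq> l2 \<and> {x. A * x\<^sup>2 + B * x + C = 0} = {l2, \<mu>} \<and>
                 g \<bullet> pt (coef1 \<mu>) \<mu> < g \<bullet> pt (coef1 l2) l2)) \<and>
          (d \<bullet> g = 0 \<longrightarrow>
            l2 = \<alpha> / norm d \<and>
            (\<exists>s\<in>{1, -1}. l1 = s * sqrt ((1 - \<alpha>\<^sup>2) / (g \<bullet> g)) \<and>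
                 g \<bullet> pt (- l1) l2 < g \<bullet> pt l1 l2)))) \<and>
      (\<bar>\<alpha>\<bar> = 1 \<longrightarrow> b = (sgn \<alpha> / norm d) *\<^sub>R d))"
proof -
  define D where "D = d \<bullet> d"
  define G where "G = g \<bullet> g"
  define m where "m = d \<bullet> g"
  define P where "P = D * G - m\<^sup>2"
  \<comment> \<open>The constraint \<open>d \<bullet> v = \<beta>\<close> determines
    \<open>c\<close> from \<open>K\<close>; unit length then becomes
    \<open>K\<^sup>2 * P + \<beta>\<^sup>2 = D\<close>, whose nonnegative root is taken.\<close>
  define K where "K = sqrt ((D - \<beta>\<^sup>2) / P)"
  define c where "c = \<beta> / D - K * m / D"
  define v where "v = K *\<^sub>R g + c *\<^sub>R d"
  have li: "p = 0 \<and> q = 0" if "p *\<^sub>R g + q *\<^sub>R d = 0" for p q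
    using independent_pair_diff[OF indep] that unfolding d .
  have P0: "P > 0"
    using gram_determinant_pos[OF li] by (simp add: P_def D_def G_def m_def)
  have D0: "D > 0" using li[of 0 1] by (auto simp: D_def)
  have G0: "G > 0" using li[of 1 0] by (auto simp: G_def)
  have nD: "(norm d)\<^sup>2 = D" by (simp add: D_def power2_norm_eq_inner)
  have n0: "norm d > 0" using D0 by (auto simp: D_def)
  have \<beta>2: "\<beta>\<^sup>2 \<le> D" using \<beta> nD by (metis abs_le_square_iff abs_norm_cancel)
  have \<alpha>\<beta>: "\<alpha> * norm d = \<beta>" using n0 \<alpha> by simp
  have \<alpha>2: "\<alpha>\<^sup>2 = \<beta>\<^sup>2 / D" using nD by (simp add: \<alpha> power_divide)
  have \<alpha>n: "\<alpha> / norm d = \<beta> / D" using nD by (simp add: \<alpha> power2_eq_square)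
  have K0: "K \<ge> 0" and K2: "K\<^sup>2 = (D - \<beta>\<^sup>2) / P"
    using \<beta>2 P0 by (simp_all add: K_def)
  have gd: "g \<bullet> d = m" by (simp add: m_def inner_commute)
  have dv: "d \<bullet> v = \<beta>"
    using D0 by (simp add: v_def c_def inner_simps D_def[symmetric] m_def[symmetric] field_simps)
  have vv: "v \<bullet> v = 1"
  proof -
    have "v \<bullet> v = K\<^sup>2 * G + 2 * K * c * m + c\<^sup>2 * D"
      by (simp add: v_def inner_simps gd D_def[symmetric] m_def[symmetric] G_def[symmetric]
          power2_eq_square algebra_simps)
    \<comment> \<open>Substituting \<open>c * D = \<beta> - K * m\<close> cancels the terms mixed in
      \<open>K\<close> and \<open>\<beta>\<close>.\<close>
    also have "\<dots> = (K\<^sup>2 * P + \<beta>\<^sup>2) / D"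
      using D0 by (simp add: c_def P_def power2_eq_square field_simps)
    finally show ?thesis using K2 P0 D0 by simp
  qed
  have sol: "solution g0 g \<beta> b \<longleftrightarrow> b = v" for b
    using is_arg_max_sphere_slice_iff[OF v_def K0 dv vv, of b]
    unfolding solution_def feasible_def[abs_def] d by simp
  have obj: "g \<bullet> pt x y = x * G + y * m" for x y
    by (simp add: pt inner_simps gd G_def)
  have coords: "l1 = K \<and> l2 = c" if "v = pt l1 l2" for l1 l2
    using li[of "l1 - K" "l2 - c"] that by (simp add: v_def pt algebra_simps)
  \<comment> \<open>Strictness here keeps the two candidate points apart and makes the comparisons
    of objectives strict.\<close>
  have interior: "K > 0" if "\<bar>\<alpha>\<bar> < 1"
  proof -
    have "\<alpha>\<^sup>2 < 1" using that by (simp add: abs_square_less_1)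
    then have "\<beta>\<^sup>2 < D" using D0 by (simp add: \<alpha>2)
    then show ?thesis using P0 by (simp add: K_def)
  qed
  have oblique: "K = coef1 c \<and> (\<exists>\<mu>. \<mu> \<noteq> c \<and> {x. A * x\<^sup>2 + B * x + C = 0} = {c, \<mu>} \<and>
      g \<bullet> pt (coef1 \<mu>) \<mu> < g \<bullet> pt (coef1 c) c)" if "\<bar>\<alpha>\<bar> < 1" "d \<bullet> g \<noteq> 0"
  proof -
    have m0: "m \<noteq> 0" using that by (simp add: m_def)
    \<comment> \<open>The point \<open>pt (- K) \<mu>\<close> is the reflection of \<open>v\<close>
      through the multiple \<open>\<beta> / D\<close> of \<open>d\<close>.\<close>
    define \<mu> where "\<mu> = \<beta> / D + K * m / D"
    have k: "coef1 c = K" "coef1 \<mu> = - K"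
      using D0 m0 by (simp_all add: coef1 \<alpha>\<beta> c_def \<mu>_def D_def[symmetric] m_def[symmetric] field_simps)
    have ne: "\<mu> \<noteq> c"
      using interior[OF that(1)] m0 D0 by (simp add: \<mu>_def c_def field_simps)
    have A': "A = D * P / m\<^sup>2"
      using m0 by (simp add: A D_def[symmetric] G_def[symmetric] m_def[symmetric] P_def field_simps)
    have B': "B = - 2 * \<beta> * P / m\<^sup>2"
      using m0 unfolding B P_def D_def[symmetric] G_def[symmetric] m_def[symmetric] \<alpha>\<beta>[symmetric]
      by (simp add: field_simps)
    have C': "C = \<beta>\<^sup>2 * G / m\<^sup>2 - 1"
      using D0 by (simp add: C \<alpha>2 D_def[symmetric] G_def[symmetric] m_def[symmetric])
    \<comment> \<open>Vieta: sum and product of \<open>c\<close> and \<open>\<mu>\<close> are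
      matched with \<open>- B / A\<close> and \<open>C / A\<close>. The product contains
      \<open>K\<close> only as a square, which \<open>P * K\<^sup>2 = D - \<beta>\<^sup>2\<close>
      eliminates.\<close>
    have sum: "c + \<mu> = 2 * \<beta> / D" by (simp add: c_def \<mu>_def)
    have "c * \<mu> = (\<beta>\<^sup>2 - K\<^sup>2 * m\<^sup>2) / D\<^sup>2"
      using D0 by (simp add: c_def \<mu>_def power2_eq_square field_simps)
    also have "D * P * \<dots> = \<beta>\<^sup>2 * G - m\<^sup>2"
    proof -
      have "D * P * ((\<beta>\<^sup>2 - K\<^sup>2 * m\<^sup>2) / D\<^sup>2) = (P * \<beta>\<^sup>2 - (P * K\<^sup>2) * m\<^sup>2) / D"
        using D0 by (simp add: power2_eq_square field_simps)
      also have "P * K\<^sup>2 = D - \<beta>\<^sup>2" using K2 P0 by simp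
      also have "(P * \<beta>\<^sup>2 - (D - \<beta>\<^sup>2) * m\<^sup>2) / D = \<beta>\<^sup>2 * G - m\<^sup>2"
        using D0 by (simp add: P_def field_simps)
      finally show ?thesis .
    qed
    finally have prod: "D * P * (c * \<mu>) = \<beta>\<^sup>2 * G - m\<^sup>2" .
    have factor: "A * x\<^sup>2 + B * x + C = A * ((x - c) * (x - \<mu>))" for x
    proof -
      have "(x - c) * (x - \<mu>) = x\<^sup>2 - (c + \<mu>) * x + c * \<mu>"
        by (simp add: power2_eq_square algebra_simps)
      moreover have "A * (c + \<mu>) = - B" using D0 by (simp add: A' B' sum)
      moreover have "A * (c * \<mu>) = C" using prod m0 by (simp add: A' C' field_simps)
      ultimately show ?thesis by (simp add: distrib_left right_diff_distrib mult.assoc[symmetric])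
    qed
    have "A \<noteq> 0" using D0 P0 m0 by (simp add: A')
    then have roots: "{x. A * x\<^sup>2 + B * x + C = 0} = {c, \<mu>}"
      by (auto simp: factor)
    \<comment> \<open>The two points differ by \<open>2 * K\<close> times the component of
      \<open>g\<close> orthogonal to \<open>d\<close>, whose squared length is
      \<open>P / D\<close>.\<close>
    have "g \<bullet> pt K c - g \<bullet> pt (- K) \<mu> = 2 * K * P / D"
      using D0 by (simp add: obj c_def \<mu>_def P_def power2_eq_square field_simps)
    also have "\<dots> > 0" using interior[OF that(1)] P0 D0 by simp
    finally show ?thesis using ne roots k by auto
  qed
  have orthogonal: "c = \<alpha> / norm d \<and> (\<exists>s\<in>{1, -1}. K = s * sqrt ((1 - \<alpha>\<^sup>2) / (g \<bullet> g)) \<and>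
      g \<bullet> pt (- K) c < g \<bullet> pt K c)" if "\<bar>\<alpha>\<bar> < 1" "d \<bullet> g = 0"
  proof -
    have m0: "m = 0" using that by (simp add: m_def)
    \<comment> \<open>Orthogonality reduces \<open>P\<close> to \<open>D * G\<close>; as
      \<open>K\<close> is a nonnegative root, the sign is \<open>s = 1\<close>.\<close>
    have "(D - \<beta>\<^sup>2) / P = (1 - \<alpha>\<^sup>2) / G"
      using D0 G0 by (simp add: P_def m0 \<alpha>2 field_simps)
    then have "K = 1 * sqrt ((1 - \<alpha>\<^sup>2) / (g \<bullet> g))" by (simp add: K_def G_def)
    moreover have "g \<bullet> pt (- K) c < g \<bullet> pt K c"
      using interior[OF that(1)] G0 by (simp add: obj m0)
    ultimately show ?thesis using \<alpha>n by (simp add: c_def m0)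
  qed
  have boundary: "v = (sgn \<alpha> / norm d) *\<^sub>R d" if "\<bar>\<alpha>\<bar> = 1"
  proof -
    have "\<alpha>\<^sup>2 = 1" using that by (metis power2_abs one_power2)
    \<comment> \<open>The plane is tangent to the sphere, so the \<open>g\<close> term drops out and
      \<open>v\<close> is \<open>\<alpha> / norm d\<close> times \<open>d\<close>.\<close>
    then have "K = 0" using D0 by (simp add: \<alpha>2 K_def field_simps)
    moreover have "sgn \<alpha> = \<alpha>" using that by (auto simp: abs_if split: if_splits)
    ultimately show ?thesis using \<alpha>n by (simp add: v_def c_def)
  qed
  have "v = pt K c" by (simp add: v_def pt)
  \<comment> \<open>Unique coordinates reduce the claims about all \<open>l1\<close>,
    \<open>l2\<close> to the single pair \<open>K\<close>, \<open>c\<close>.\<close>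
  then have "(\<exists>l1 l2. v = pt l1 l2) \<and> (\<forall>l1 l2. v = pt l1 l2 \<longrightarrow> l1 = K \<and> l2 = c)"
    using coords by blast
  then show ?thesis
    unfolding sol using oblique orthogonal boundary by auto
qed

end
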